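(* There are an absolute constant $K$ and a polynomial $p$ such that the following holds for every sufficiently large $n$. Let $f\in\mathcal F_n$ and let $s$ satisfy $K^{1/7}s\ge n$, and assume that $f$ is not computed by any circuit over $\{\neg,\wedge_2,\vee_2\}$ of size at most $Ks^7$. Then there exist a set $S\subseteq\{0,1\}^n$ of anticheckers of $f$ (i.e. $|S|\le p(s)$ and no circuit over $\{\neg,\wedge_2,\vee_2\}$ of size at most $s^3$ agrees with $f$ on all of $S$) and a set $F_0$ of semi-filters $F\subseteq\mathcal P(U\cap S)$ with $v(F)\in V\cap S$, such that $|F_0|\le 2^{p(s)}$ and $\rho^S_{F_0}(f)\ge s$.
   Context: $\mathcal F_n$ is the set of Boolean functions $\{0,1\}^n\to\{0,1\}$. For $f\in\mathcal F_n$ let $V:=f^{-1}(1)$, $U:=f^{-1}(0)$. Fix $S\subseteq\{0,1\}^n$. For $g\in\mathcal F_n$ let $[[g]]:=g^{-1}(1)\cap U\cap S$. A semi-filter is a family $F\subseteq\mathcal P(U\cap S)$ (also viewed as a predicate, $F(A)=1$ iff $A\in F$) such that $F(\emptyset)=0$, $F(U\cap S)=1$, and $A\subseteq B\Rightarrow F(A)\le F(B)$. For a semi-filter $F$, "$v(F)\in V\cap S$" means that $F([[x_i]])\ne F([[\neg x_i]])$ for every $i\in[n]$, and the string $v(F)\in\{0,1\}^n$ defined by $v(F)_i:=F([[x_i]])$ lies in $V\cap S$. A pair $(A,B)$ of subsets of $U\cap S$ covers $F$ if $F(A)=F(B)=1$ but $F(A\cap B)=0$. For a set $F_0$ of such semi-filters,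 $\rho^S_{F_0}(f)$ is the minimal number of pairs $(A,B)$, $A,B\subseteq U\cap S$, such that every $F\in F_0$ is covered by one of the pairs. *)

theory Defs
  imports Complex_Main "HOL-Computational_Algebra.Polynomial"
begin

section \<open>Boolean functions\<close>

text \<open>
  The cube \<open>{0,1}\<^sup>n\<close> consists of the Boolean lists of length \<open>n\<close>, with coordinates
  indexed by \<open>0, \<dots>, n - 1\<close>.  A Boolean function on \<open>n\<close> variables is given by any
  function on Boolean lists; every notion below depends only on its values on the cube.
\<close>

definition cube :: "nat \<Rightarrow> bool list set" where
  "cube n = {x. length x = n}"

definition ones :: "nat \<Rightarrow> (bool list \<Rightarrow> bool) \<Rightarrow> bool list set" where
  "ones n f = {x \<in> cube n. f x}"

definition zeros :: "nat \<Rightarrow> (bool list \<Rightarrow> bool) \<Rightarrow> bool list set" where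
  "zeros n f = {x \<in> cube n. \<not> f x}"


section \<open>Circuits over negation and binary conjunction and disjunction\<close>

text \<open>
  A circuit on \<open>n\<close> inputs is a topologically ordered list of gates together with an output
  wire.  Wires \<open>0, \<dots>, n - 1\<close> are the inputs, and wire \<open>n + k\<close> is the output of the
  \<open>k\<close>-th gate, which may read only wires below \<open>n + k\<close>.  Gates have unbounded fan-out.
  The size is the number of gates, negations included.
\<close>

datatype gate = NotG nat | AndG nat nat | OrG nat nat

type_synonym circuit = "gate list \<times> nat"

fun gate_wires :: "gate \<Rightarrow> nat set" where
  "gate_wires (NotG i) = {i}"
| "gate_wires (AndG i j) = {i, j}"
| "gate_wires (OrG i j) = {i, j}"

fun gate_val :: "bool list \<Rightarrow> gate \<Rightarrow> bool" where
  "gate_val w (NotG i) = (\<not> w ! i)"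
| "gate_val w (AndG i j) = (w ! i \<and> w ! j)"
| "gate_val w (OrG i j) = (w ! i \<or> w ! j)"

definition is_circuit :: "nat \<Rightarrow> circuit \<Rightarrow> bool" where
  "is_circuit n C \<longleftrightarrow>
     (\<forall>k < length (fst C). \<forall>i \<in> gate_wires (fst C ! k). i < n + k) \<and>
     snd C < n + length (fst C)"

definition circuit_size :: "circuit \<Rightarrow> nat" where
  "circuit_size C = length (fst C)"

definition wire_vals :: "gate list \<Rightarrow> bool list \<Rightarrow> bool list" where
  "wire_vals gs x = foldl (\<lambda>w g. w @ [gate_val w g]) x gs"

definition circuit_val :: "circuit \<Rightarrow> bool list \<Rightarrow> bool" where
  "circuit_val C x = wire_vals (fst C) x ! snd C"

definition agrees_on :: "circuit \<Rightarrow> (bool list \<Rightarrow> bool) \<Rightarrow> bool list set \<Rightarrow> bool" where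
  "agrees_on C f S \<longleftrightarrow> (\<forall>x \<in> S. circuit_val C x = f x)"

definition computes :: "nat \<Rightarrow> circuit \<Rightarrow> (bool list \<Rightarrow> bool) \<Rightarrow> bool" where
  "computes n C f \<longleftrightarrow> is_circuit n C \<and> agrees_on C f (cube n)"

definition anticheckers ::
    "nat \<Rightarrow> (bool list \<Rightarrow> bool) \<Rightarrow> nat \<Rightarrow> nat \<Rightarrow> bool list set \<Rightarrow> bool" where
  "anticheckers n f m t S \<longleftrightarrow>
     S \<subseteq> cube n \<and> card S \<le> m \<and>
     \<not> (\<exists>C. is_circuit n C \<and> circuit_size C \<le> t \<and> agrees_on C f S)"


section \<open>Semi-filters and the cover complexity\<close>

text \<open>The set \<open>[[g]] = g\<^sup>-\<^sup>1(1) \<inter> U \<inter> S\<close>, where \<open>U\<close> is the zero set of \<open>f\<close>.\<close>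

definition bracket ::
    "nat \<Rightarrow> (bool list \<Rightarrow> bool) \<Rightarrow> bool list set \<Rightarrow> (bool list \<Rightarrow> bool) \<Rightarrow> bool list set" where
  "bracket n f S g = ones n g \<inter> zeros n f \<inter> S"

definition semi_filter :: "bool list set \<Rightarrow> bool list set set \<Rightarrow> bool" where
  "semi_filter W F \<longleftrightarrow>
     F \<subseteq> Pow W \<and> {} \<notin> F \<and> W \<in> F \<and>
     (\<forall>A B. A \<subseteq> B \<and> B \<subseteq> W \<and> A \<in> F \<longrightarrow> B \<in> F)"

definition vstring ::
    "nat \<Rightarrow> (bool list \<Rightarrow> bool) \<Rightarrow> bool list set \<Rightarrow> bool list set set \<Rightarrow> bool list" where
  "vstring n f S F = map (\<lambda>i. bracket n f S (\<lambda>x. x ! i) \<in> F) [0..<n]"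

text \<open>The condition written \<open>v(F) \<in> V \<inter> S\<close>, including that \<open>v(F)\<close> is well defined.\<close>

definition v_in_VS ::
    "nat \<Rightarrow> (bool list \<Rightarrow> bool) \<Rightarrow> bool list set \<Rightarrow> bool list set set \<Rightarrow> bool" where
  "v_in_VS n f S F \<longleftrightarrow>
     (\<forall>i < n. (bracket n f S (\<lambda>x. x ! i) \<in> F) \<noteq> (bracket n f S (\<lambda>x. \<not> x ! i) \<in> F)) \<and>
     vstring n f S F \<in> ones n f \<inter> S"

definition covers :: "bool list set \<times> bool list set \<Rightarrow> bool list set set \<Rightarrow> bool" where
  "covers P F \<longleftrightarrow> fst P \<in> F \<and> snd P \<in> F \<and> fst P \<inter> snd P \<notin> F"

definition covering ::
    "bool list set \<Rightarrow> bool list set set set \<Rightarrow> (bool list set \<times> bool list set) set \<Rightarrow> bool" where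
  "covering W F0 \<Lambda> \<longleftrightarrow>
     \<Lambda> \<subseteq> Pow W \<times> Pow W \<and> finite \<Lambda> \<and> (\<forall>F \<in> F0. \<exists>P \<in> \<Lambda>. covers P F)"

definition rho ::
    "nat \<Rightarrow> (bool list \<Rightarrow> bool) \<Rightarrow> bool list set \<Rightarrow> bool list set set set \<Rightarrow> nat" where
  "rho n f S F0 = (LEAST k. \<exists>\<Lambda>. covering (zeros n f \<inter> S) F0 \<Lambda> \<and> card \<Lambda> = k)"

text \<open>
  The minimum in \<open>rho\<close> is taken over a nonempty set for the families \<open>F0\<close> of interest:
  a semi-filter with \<open>v(F) \<in> V \<inter> S\<close> cannot be closed under intersections.
\<close>

lemma finite_cube: "finite (cube n)"
  unfolding cube_def using finite_lists_length_eq[of "UNIV :: bool set" n] by simp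

lemma ex_cover:
  assumes sf: "semi_filter (zeros n f \<inter> S) F" and v: "v_in_VS n f S F"
  shows "\<exists>P \<in> Pow (zeros n f \<inter> S) \<times> Pow (zeros n f \<inter> S). covers P F"
proof (rule ccontr)
  assume nc: "\<not> ?thesis"
  define W where "W = zeros n f \<inter> S"
  define u where "u = vstring n f S F"
  define G where "G k = {x \<in> W. \<forall>i < k. x ! i = u ! i}" for k
  have FW: "F \<subseteq> Pow W" "W \<in> F" "{} \<notin> F"
    using sf by (auto simp: semi_filter_def W_def)
  have closed: "A \<inter> B \<in> F" if "A \<in> F" "B \<in> F" for A B
  proof -
    have "(A, B) \<in> Pow W \<times> Pow W" using FW(1) that by blast
    with nc that show ?thesis by (auto simp: covers_def W_def)
  qed
  have "G k \<in> F" if "k \<le> n" for k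
    using that
  proof (induction k)
    case 0
    then show ?case using FW(2) by (simp add: G_def)
  next
    case (Suc k)
    have uk: "u ! k \<longleftrightarrow> bracket n f S (\<lambda>x. x ! k) \<in> F"
      using Suc.prems by (simp add: u_def vstring_def)
    have "{x \<in> W. x ! k = u ! k} \<in> F"
    proof (cases "u ! k")
      case True
      have "{x \<in> W. x ! k = u ! k} = bracket n f S (\<lambda>x. x ! k)"
        using True by (auto simp: bracket_def ones_def zeros_def W_def)
      then show ?thesis using uk True by simp
    next
      case False
      have "{x \<in> W. x ! k = u ! k} = bracket n f S (\<lambda>x. \<not> x ! k)"
        using False by (auto simp: bracket_def ones_def zeros_def W_def)
      moreover have "bracket n f S (\<lambda>x. \<not> x ! k) \<in> F"
        using v uk False Suc.prems by (auto simp: v_in_VS_def)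
      ultimately show ?thesis by simp
    qed
    then have "G k \<inter> {x \<in> W. x ! k = u ! k} \<in> F"
      using closed Suc by simp
    moreover have "G (Suc k) = G k \<inter> {x \<in> W. x ! k = u ! k}"
      by (auto simp: G_def less_Suc_eq)
    ultimately show ?case by simp
  qed
  then have "G n \<in> F" by simp
  moreover have "G n = {}"
  proof -
    have u: "length u = n" "f u"
      using v by (auto simp: v_in_VS_def u_def ones_def cube_def)
    have "x = u" if "x \<in> G n" for x
      using that u by (auto simp: G_def W_def zeros_def cube_def intro: nth_equalityI)
    then show ?thesis using u by (auto simp: G_def W_def zeros_def)
  qed
  ultimately show False using FW(3) by simp
qed

lemma ex_covering:
  assumes "\<forall>F \<in> F0. semi_filter (zeros n f \<inter> S) F \<and> v_in_VS n f S F"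
  shows "\<exists>\<Lambda>. covering (zeros n f \<inter> S) F0 \<Lambda>"
proof -
  have "finite (zeros n f \<inter> S)"
    using finite_cube[of n] by (simp add: zeros_def)
  then have "finite (Pow (zeros n f \<inter> S) \<times> Pow (zeros n f \<inter> S))"
    by (intro finite_cartesian_product) (simp_all only: finite_Pow_iff)
  moreover have "\<forall>F \<in> F0. \<exists>P \<in> Pow (zeros n f \<inter> S) \<times> Pow (zeros n f \<inter> S). covers P F"
    using assms by (intro ballI ex_cover) auto
  ultimately show ?thesis
    unfolding covering_def by blast
qed

end

theory Submission
  imports Defs
begin

text \<open>
  Take \<open>K = 1\<close>, so that \<open>n \<le> s\<close>. Keep the class of circuits of size at most \<open>s\<^sup>4\<close> that agree with
  \<open>f\<close> so far, and repeatedly add to \<open>S\<close> a point on which at least a quarter of them err. If this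
  never gets stuck, \<open>S\<close> refutes all of them after logarithmically many steps. If it gets stuck,
  every input is handled correctly by more than three quarters of the current class, and the
  majority of some \<open>6n\<close> of its members computes \<open>f\<close> with at most \<open>s\<^sup>7\<close> gates.

  Given fewer than \<open>s\<close> pairs and an input \<open>x\<close>, generate the least family of sets that contains
  the brackets of the literals true at \<open>x\<close> and is closed under supersets and under the pairs, and
  accept \<open>x\<close> if it contains the bracket of a literal false at \<open>x\<close>. This takes \<open>O(s\<^sup>3)\<close> gates
  and rejects every \<open>x\<close> in \<open>U \<inter> S\<close>, since all generated sets contain \<open>x\<close>. Hence it rejects some
  \<open>x\<close> in \<open>V \<inter> S\<close>, and the family generated from that \<open>x\<close> is a semi-filter that no pair covers.
  Choosing one uncovered semi-filter for every set of fewer than \<open>s\<close> pairs gives \<open>F\<^sub>0\<close>.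
\<close>

section \<open>Straight-line programs\<close>

text \<open>A circuit is represented by the set of all functions computed on its wires, so that
  composing circuits needs no renumbering of wires.\<close>

inductive slp :: "('x \<Rightarrow> bool) set \<Rightarrow> nat \<Rightarrow> ('x \<Rightarrow> bool) set \<Rightarrow> bool" for B where
  init: "slp B 0 B"
| neg: "slp B N G \<Longrightarrow> g \<in> G \<Longrightarrow> slp B (Suc N) (insert (\<lambda>x. \<not> g x) G)"
| conj: "slp B N G \<Longrightarrow> g \<in> G \<Longrightarrow> h \<in> G \<Longrightarrow> slp B (Suc N) (insert (\<lambda>x. g x \<and> h x) G)"
| disj: "slp B N G \<Longrightarrow> g \<in> G \<Longrightarrow> h \<in> G \<Longrightarrow> slp B (Suc N) (insert (\<lambda>x. g x \<or> h x) G)"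

lemma slp_trans: "slp G M H \<Longrightarrow> slp B N G \<Longrightarrow> slp B (N + M) H"
  by (induction rule: slp.induct) (auto intro: slp.intros)

text \<open>Extra base functions are free wires that ride along unchanged, so a program runs in any
  larger context; weakening and composing cost bounds rest on this.\<close>

lemma slp_union: "slp B N G \<Longrightarrow> slp (B \<union> D) N (G \<union> D)"
  by (induction rule: slp.induct) (auto intro: slp.intros)

lemma slp_superset: "slp B N G \<Longrightarrow> B \<subseteq> G"
  by (induction rule: slp.induct) auto

text \<open>All targets in \<open>T\<close> must lie on the wires of one program, so subcircuits
  shared between them are paid for once.\<close>

definition cost_le :: "('x \<Rightarrow> bool) set \<Rightarrow> nat \<Rightarrow> ('x \<Rightarrow> bool) set \<Rightarrow> bool" where
  "cost_le B N T \<longleftrightarrow> (\<exists>M G. M \<le> N \<and> slp B M G \<and> T \<subseteq> G)"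

lemma cost_le_mono:
  assumes "cost_le B N T" "B \<subseteq> B'" "N \<le> N'" "T' \<subseteq> T"
  shows "cost_le B' N' T'"
proof -
  obtain M G where "M \<le> N" "slp B M G" "T \<subseteq> G"
    using assms(1) by (auto simp: cost_le_def)
  moreover from this have "slp B' M (G \<union> B')"
    using slp_union[of B M G B'] assms(2) by (simp add: Un_absorb1)
  ultimately show ?thesis
    using assms unfolding cost_le_def by (meson dual_order.trans le_supI1)
qed

lemma cost_le_subset: "T \<subseteq> B \<Longrightarrow> cost_le B 0 T"
  by (auto simp: cost_le_def intro: slp.init)

lemma cost_le_trans:
  assumes "cost_le B N T" "cost_le (B \<union> T) M T'"
  shows "cost_le B (N + M) (T \<union> T')"
proof -
  obtain N' G where 1: "N' \<le> N" "slp B N' G" "T \<subseteq> G"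
    using assms(1) by (auto simp: cost_le_def)
  obtain M' H where 2: "M' \<le> M" "slp (B \<union> T) M' H" "T' \<subseteq> H"
    using assms(2) by (auto simp: cost_le_def)
  \<comment> \<open>Every wire the second program starts from is already a wire of the first, so
    with \<open>G\<close> added to its base it becomes a continuation of the first.\<close>
  have "B \<union> T \<union> G = G"
    using slp_superset[OF 1(2)] 1(3) by blast
  then have "slp G M' (H \<union> G)"
    using slp_union[OF 2(2), of G] by simp
  then have "slp B (N' + M') (H \<union> G)"
    using 1(2) by (rule slp_trans)
  then show ?thesis
    unfolding cost_le_def using 1 2 by (intro exI[of _ "N' + M'"] exI[of _ "H \<union> G"]) auto
qed

lemma cost_le_seq:
  assumes "cost_le B N T" "cost_le (B \<union> T) M T'"
  shows "cost_le B (N + M) T'"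
  using cost_le_mono[OF cost_le_trans[OF assms]] by blast

lemma cost_le_Un:
  assumes "cost_le B N T" "cost_le B M T'"
  shows "cost_le B (N + M) (T \<union> T')"
  using cost_le_trans[OF assms(1) cost_le_mono[OF assms(2)]] by blast

lemma cost_le_UN:
  assumes "finite I" "\<And>i. i \<in> I \<Longrightarrow> cost_le B N (T i)"
  shows "cost_le B (card I * N) (\<Union>i\<in>I. T i)"
  using assms
proof (induction I rule: finite_induct)
  case empty
  then show ?case by (simp add: cost_le_subset)
next
  case (insert i I)
  then have "cost_le B (N + card I * N) (T i \<union> (\<Union>i\<in>I. T i))"
    by (intro cost_le_Un) auto
  with insert show ?case by simp
qed

lemma cost_le_neg: "g \<in> B \<Longrightarrow> cost_le B 1 {\<lambda>x. \<not> g x}"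
  unfolding cost_le_def by (rule exI[of _ 1], rule exI[of _ "insert (\<lambda>x. \<not> g x) B"])
    (auto intro: slp.neg[OF slp.init, simplified])

lemma cost_le_conj: "g \<in> B \<Longrightarrow> h \<in> B \<Longrightarrow> cost_le B 1 {\<lambda>x. g x \<and> h x}"
  unfolding cost_le_def by (rule exI[of _ 1], rule exI[of _ "insert (\<lambda>x. g x \<and> h x) B"])
    (auto intro: slp.conj[OF slp.init, simplified])

lemma cost_le_disj: "g \<in> B \<Longrightarrow> h \<in> B \<Longrightarrow> cost_le B 1 {\<lambda>x. g x \<or> h x}"
  unfolding cost_le_def by (rule exI[of _ 1], rule exI[of _ "insert (\<lambda>x. g x \<or> h x) B"])
    (auto intro: slp.disj[OF slp.init, simplified])

text \<open>The constant False starts the chain of disjunctions: one gate per index, and the empty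
  index set is free.\<close>

lemma cost_le_Bex:
  assumes "finite I" "(\<lambda>_. False) \<in> B" "\<And>i. i \<in> I \<Longrightarrow> g i \<in> B"
  shows "cost_le B (card I) {\<lambda>x. \<exists>i\<in>I. g i x}"
  using assms
proof (induction I rule: finite_induct)
  case empty
  then show ?case by (simp add: cost_le_subset)
next
  case (insert i I)
  have "cost_le (B \<union> {\<lambda>x. \<exists>i\<in>I. g i x}) 1 {\<lambda>x. g i x \<or> (\<exists>i\<in>I. g i x)}"
    using insert by (intro cost_le_disj) auto
  then have "cost_le B (card I + 1) {\<lambda>x. g i x \<or> (\<exists>i\<in>I. g i x)}"
    using insert by (intro cost_le_seq[of B "card I"]) auto
  with insert show ?case by simp
qed

text \<open>The basis has no constants; they come from one wire \<open>g\<close> as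
  \<open>g \<and> \<not> g\<close> and \<open>g \<or> \<not> g\<close>, sharing the
  negation.\<close>

lemma cost_le_consts:
  assumes "B \<noteq> {}"
  shows "cost_le B 3 {\<lambda>_. False, \<lambda>_. True}"
proof -
  obtain g where g: "g \<in> B" using assms by blast
  have "cost_le (B \<union> {\<lambda>x. \<not> g x}) (1 + 1) ({\<lambda>x. g x \<and> \<not> g x} \<union> {\<lambda>x. g x \<or> \<not> g x})"
    using g by (intro cost_le_Un cost_le_conj cost_le_disj) auto
  then show ?thesis
    using cost_le_seq[OF cost_le_neg[OF g]] by (simp add: insert_commute numeral_3_eq_3 numeral_2_eq_2)
qed

section \<open>Threshold functions\<close>

definition threshold :: "('x \<Rightarrow> bool) list \<Rightarrow> nat \<Rightarrow> 'x \<Rightarrow> bool" where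
  "threshold hs k x \<longleftrightarrow> k \<le> length (filter (\<lambda>h. h x) hs)"

text \<open>Dynamic programming over the list: all thresholds up to \<open>L\<close> of the tail are
  kept, and each threshold of the longer list costs at most two more gates.\<close>

lemma cost_le_threshold:
  assumes "(\<lambda>_. False) \<in> B" "(\<lambda>_. True) \<in> B" "set hs \<subseteq> B"
  shows "cost_le B (length hs * (2 * Suc L)) (threshold hs ` {..L})"
  using assms(3)
proof (induction hs)
  case Nil
  have "threshold [] k \<in> B" for k
    using assms by (cases k) (auto simp: threshold_def[abs_def])
  then show ?case by (auto intro: cost_le_subset)
next
  case (Cons h hs)
  let ?B = "B \<union> threshold hs ` {..L}"
  have step: "cost_le ?B 2 {threshold (h # hs) k}" if "k \<in> {..L}" for k
  proof (cases k)
    case 0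
    then have "threshold (h # hs) k = (\<lambda>_. True)"
      by (simp add: threshold_def[abs_def])
    then show ?thesis
      using cost_le_mono[OF cost_le_subset[of "{\<lambda>_. True}" ?B]] assms by simp
  next
    case (Suc j)
    have eq: "threshold (h # hs) k = (\<lambda>x. threshold hs k x \<or> (threshold hs j x \<and> h x))"
      by (auto simp: threshold_def fun_eq_iff Suc)
    have "cost_le ?B 1 {\<lambda>x. threshold hs j x \<and> h x}"
      using that Suc Cons.prems by (intro cost_le_conj) auto
    moreover have "cost_le (?B \<union> {\<lambda>x. threshold hs j x \<and> h x}) 1 {threshold (h # hs) k}"
      unfolding eq using that by (intro cost_le_disj) auto
    ultimately have "cost_le ?B (1 + 1) {threshold (h # hs) k}"
      by (rule cost_le_seq)
    then show ?thesis by (simp add: numeral_2_eq_2)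
  qed
  have "cost_le ?B (card {..L} * 2) (\<Union>k\<in>{..L}. {threshold (h # hs) k})"
    using step by (intro cost_le_UN) auto
  moreover have "cost_le B (length hs * (2 * Suc L)) (threshold hs ` {..L})"
    using Cons by simp
  ultimately have "cost_le B (length hs * (2 * Suc L) + card {..L} * 2)
      (\<Union>k\<in>{..L}. {threshold (h # hs) k})"
    by (rule cost_le_seq[rotated])
  moreover have "(\<Union>k\<in>{..L}. {threshold (h # hs) k}) = threshold (h # hs) ` {..L}"
    by auto
  ultimately show ?case
    by (simp add: algebra_simps)
qed


section \<open>Circuits as straight-line programs\<close>

definition inputs :: "nat \<Rightarrow> (bool list \<Rightarrow> bool) set" where
  "inputs n = (\<lambda>i x. x ! i) ` {..<n}"

lemma wire_vals_Nil [simp]: "wire_vals [] x = x"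
  by (simp add: wire_vals_def)

lemma wire_vals_snoc [simp]:
  "wire_vals (gs @ [g]) x = wire_vals gs x @ [gate_val (wire_vals gs x) g]"
  by (simp add: wire_vals_def)

lemma length_wire_vals [simp]: "length (wire_vals gs x) = length x + length gs"
  by (induction gs rule: rev_induct) auto

definition wf_gates :: "nat \<Rightarrow> gate list \<Rightarrow> bool" where
  "wf_gates n gs \<longleftrightarrow> (\<forall>k < length gs. \<forall>i \<in> gate_wires (gs ! k). i < n + k)"

lemma wf_gates_snoc:
  "wf_gates n (gs @ [g]) \<longleftrightarrow> wf_gates n gs \<and> (\<forall>i \<in> gate_wires g. i < n + length gs)"
  by (auto simp: wf_gates_def nth_append less_Suc_eq all_conj_distrib)

lemma is_circuit_iff: "is_circuit n (gs, i) \<longleftrightarrow> wf_gates n gs \<and> i < n + length gs"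
  by (simp add: is_circuit_def wf_gates_def)

text \<open>Agreement is demanded on the cube only: on lists of another length the wire numbers
  point at the wrong entries.\<close>

definition realizes :: "nat \<Rightarrow> gate list \<Rightarrow> nat \<Rightarrow> (bool list \<Rightarrow> bool) \<Rightarrow> bool" where
  "realizes n gs i g \<longleftrightarrow> i < n + length gs \<and> (\<forall>x \<in> cube n. wire_vals gs x ! i = g x)"

lemma realizes_snoc: "realizes n gs i g \<Longrightarrow> realizes n (gs @ [a]) i g"
  by (auto simp: realizes_def nth_append cube_def)

lemma realizes_last:
  assumes "\<And>x. x \<in> cube n \<Longrightarrow> gate_val (wire_vals gs x) a = g x"
  shows "realizes n (gs @ [a]) (n + length gs) g"
  using assms by (auto simp: realizes_def nth_append cube_def)

text \<open>Each rule appends one gate while earlier functions keep their wires; the local fact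
  \<open>snoc\<close> treats the three gate types at once.\<close>

lemma slp_imp_gates:
  assumes "slp (inputs n) N G"
  shows "\<exists>gs. wf_gates n gs \<and> length gs = N \<and> (\<forall>g \<in> G. \<exists>i. realizes n gs i g)"
proof -
  have snoc: "\<exists>gs. wf_gates n gs \<and> length gs = Suc N \<and> (\<forall>g \<in> insert h G. \<exists>i. realizes n gs i g)"
    if "wf_gates n gs" "length gs = N" "\<forall>g \<in> G. \<exists>i. realizes n gs i g"
      "\<forall>i \<in> gate_wires a. i < n + length gs"
      "\<And>x. x \<in> cube n \<Longrightarrow> gate_val (wire_vals gs x) a = h x" for gs a h N G
  proof -
    have "realizes n (gs @ [a]) (n + length gs) h"
      using that(5) by (rule realizes_last)
    then have "\<forall>g \<in> insert h G. \<exists>i. realizes n (gs @ [a]) i g"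
      using that(3) by (blast intro: realizes_snoc)
    then show ?thesis
      using that by (intro exI[of _ "gs @ [a]"]) (auto simp: wf_gates_snoc)
  qed
  from assms show ?thesis
  proof (induction rule: slp.induct)
    case init
    show ?case
      by (rule exI[of _ "[]"]) (auto simp: wf_gates_def inputs_def realizes_def)
  next
    case (neg N G g)
    then obtain gs i where "wf_gates n gs" "length gs = N" "\<forall>g \<in> G. \<exists>i. realizes n gs i g"
      "realizes n gs i g"
      by blast
    then show ?case
      by (intro snoc[of gs N G "NotG i"]) (auto simp: realizes_def)
  next
    case (conj N G g h)
    then obtain gs i j where "wf_gates n gs" "length gs = N" "\<forall>g \<in> G. \<exists>i. realizes n gs i g"
      "realizes n gs i g" "realizes n gs j h"
      by blast
    then show ?case
      by (intro snoc[of gs N G "AndG i j"]) (auto simp: realizes_def)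
  next
    case (disj N G g h)
    then obtain gs i j where "wf_gates n gs" "length gs = N" "\<forall>g \<in> G. \<exists>i. realizes n gs i g"
      "realizes n gs i g" "realizes n gs j h"
      by blast
    then show ?case
      by (intro snoc[of gs N G "OrG i j"]) (auto simp: realizes_def)
  qed
qed

text \<open>Needed to feed given circuits into the cost calculus, as the majority construction
  does.\<close>

lemma gates_imp_slp:
  assumes "wf_gates n gs"
  shows "\<exists>G. slp (inputs n) (length gs) G \<and> (\<forall>i < n + length gs. \<exists>g \<in> G. realizes n gs i g)"
  using assms
proof (induction gs rule: rev_induct)
  case Nil
  show ?case
    by (rule exI[of _ "inputs n"]) (auto simp: inputs_def realizes_def intro: slp.init)
next
  case (snoc a gs)
  then obtain G where G: "slp (inputs n) (length gs) G"
    "\<forall>i < n + length gs. \<exists>g \<in> G. realizes n gs i g"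
    by (auto simp: wf_gates_snoc)
  have "\<exists>h. slp (inputs n) (Suc (length gs)) (insert h G) \<and>
      (\<forall>x \<in> cube n. gate_val (wire_vals gs x) a = h x)"
  proof (cases a)
    case (NotG i)
    then obtain g where "g \<in> G" "realizes n gs i g"
      using snoc.prems G by (auto simp: wf_gates_snoc)
    then show ?thesis
      using slp.neg[OF G(1), of g] NotG by (auto simp: realizes_def)
  next
    case (AndG i j)
    then obtain g h where "g \<in> G" "realizes n gs i g" "h \<in> G" "realizes n gs j h"
      using snoc.prems G by (auto simp: wf_gates_snoc) blast
    then show ?thesis
      using slp.conj[OF G(1), of g h] AndG by (auto simp: realizes_def)
  next
    case (OrG i j)
    then obtain g h where "g \<in> G" "realizes n gs i g" "h \<in> G" "realizes n gs j h"
      using snoc.prems G by (auto simp: wf_gates_snoc) blast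
    then show ?thesis
      using slp.disj[OF G(1), of g h] OrG by (auto simp: realizes_def)
  qed
  then obtain h where h: "slp (inputs n) (Suc (length gs)) (insert h G)"
    "\<And>x. x \<in> cube n \<Longrightarrow> gate_val (wire_vals gs x) a = h x"
    by blast
  have "\<exists>g \<in> insert h G. realizes n (gs @ [a]) i g" if "i < n + length (gs @ [a])" for i
  proof (cases "i = n + length gs")
    case True
    then show ?thesis using realizes_last[OF h(2)] by auto
  next
    case False
    then have "i < n + length gs" using that by simp
    then show ?thesis using G(2) by (blast intro: realizes_snoc)
  qed
  then show ?case using h(1) by auto
qed

lemma cost_le_imp_circuit:
  assumes "cost_le (inputs n) N {g}"
  obtains C where "is_circuit n C" "circuit_size C \<le> N" "agrees_on C g (cube n)"
proof -
  obtain M G where G: "M \<le> N" "slp (inputs n) M G" "g \<in> G"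
    using assms by (auto simp: cost_le_def)
  then obtain gs i where "wf_gates n gs" "length gs = M" "realizes n gs i g"
    using slp_imp_gates by blast
  then show ?thesis
    using G(1) by (intro that[of "(gs, i)"])
      (auto simp: is_circuit_iff circuit_size_def agrees_on_def circuit_val_def realizes_def)
qed

lemma circuit_imp_cost_le:
  assumes "is_circuit n C"
  obtains g where "cost_le (inputs n) (circuit_size C) {g}" "agrees_on C g (cube n)"
proof -
  obtain gs i where C: "C = (gs, i)" by fastforce
  then obtain G g where "slp (inputs n) (length gs) G" "g \<in> G" "realizes n gs i g"
    using assms gates_imp_slp[of n gs] by (auto simp: is_circuit_iff)
  then show ?thesis
    using C by (intro that[of g])
      (auto simp: cost_le_def circuit_size_def agrees_on_def circuit_val_def realizes_def)
qed


section \<open>Anticheckers\<close>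

text \<open>Greedy choice: each new point removes at least a quarter of the surviving class, so at
  most \<open>(3/4)^M * card C < 1\<close> elements survive \<open>M\<close> rounds.\<close>

lemma ex_small_refuting_set:
  assumes "finite C" "3 ^ M * card C < 4 ^ M"
    and stuck: "\<And>D. D \<subseteq> C \<Longrightarrow> D \<noteq> {} \<Longrightarrow> \<exists>x\<in>X. card D \<le> 4 * card {c \<in> D. wrong c x}"
  shows "\<exists>S \<subseteq> X. finite S \<and> card S \<le> M \<and> (\<forall>c\<in>C. \<exists>x\<in>S. wrong c x)"
  using assms
proof (induction M arbitrary: C)
  case 0
  then show ?case by (intro exI[of _ "{}"]) auto
next
  case (Suc M)
  show ?case
  proof (cases "C = {}")
    case True
    then show ?thesis by (intro exI[of _ "{}"]) auto
  next
    case False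
    then obtain x where x: "x \<in> X" "card C \<le> 4 * card {c \<in> C. wrong c x}"
      using Suc.prems(3)[of C] by blast
    let ?D = "{c \<in> C. \<not> wrong c x}"
    have "C = {c \<in> C. wrong c x} \<union> ?D" by blast
    then have "card C = card {c \<in> C. wrong c x} + card ?D"
      using Suc.prems(1) by (metis (no_types, lifting) card_Un_disjoint disjoint_iff finite_Un mem_Collect_eq)
    then have "4 * card ?D \<le> 3 * card C"
      using x(2) by simp
    then have "3 ^ M * (4 * card ?D) \<le> 3 ^ M * (3 * card C)"
      by (rule mult_left_mono) simp
    also have "\<dots> < 4 * 4 ^ M"
      using Suc.prems(2) by simp
    finally have "4 * (3 ^ M * card ?D) < 4 * 4 ^ M"
      by (simp only: mult.left_commute)
    then have "3 ^ M * card ?D < 4 ^ M"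
      by linarith
    then obtain S where "S \<subseteq> X" "finite S" "card S \<le> M" "\<forall>c\<in>?D. \<exists>x\<in>S. wrong c x"
      using Suc.IH[of ?D] Suc.prems(1,3) by (smt (verit) finite_subset mem_Collect_eq subset_iff)
    then show ?thesis
      using x(1) by (intro exI[of _ "insert x S"]) (auto simp: card_insert_if)
  qed
qed

text \<open>The uniform distribution on a good class is sampled greedily, by the method of conditional
  expectations: each choice shrinks the potential by a factor \<open>7/8\<close>.\<close>

lemma small_potential:
  fixes X :: "'x set"
  assumes "finite D" "D \<noteq> {}" "finite X"
    and few: "\<And>x. x \<in> X \<Longrightarrow> 4 * card {c \<in> D. wrong c x} \<le> card D"
  shows "\<exists>cs. length cs = l \<and> set cs \<subseteq> D \<and>
    (\<Sum>x\<in>X. \<Prod>c\<leftarrow>cs. if wrong c x then 2 else 1 / 2 :: real) \<le> real (card X) * (7 / 8) ^ l"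
proof (induction l)
  case 0
  then show ?case by simp
next
  case (Suc l)
  define \<phi> :: "_ \<Rightarrow> 'x \<Rightarrow> real" where "\<phi> c x = (if wrong c x then 2 else 1 / 2)" for c x
  obtain cs where cs: "length cs = l" "set cs \<subseteq> D"
    "(\<Sum>x\<in>X. \<Prod>c\<leftarrow>cs. \<phi> c x) \<le> real (card X) * (7 / 8) ^ l"
    using Suc by (auto simp: \<phi>_def)
  define w where "w x = (\<Prod>c\<leftarrow>cs. \<phi> c x)" for x
  have w: "w x \<ge> 0" for x
    unfolding w_def by (rule prod_list_nonneg) (auto simp: \<phi>_def)
  \<comment> \<open>Members wrong at \<open>x\<close>, at most a quarter of \<open>D\<close>,
    contribute 2 and the others 1/2; the worst average is \<open>2/4 + 3/8 = 7/8\<close>.\<close>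
  have avg: "(\<Sum>c\<in>D. \<phi> c x) \<le> 7 / 8 * real (card D)" if "x \<in> X" for x
  proof -
    have "(\<Sum>c\<in>D. \<phi> c x) = (\<Sum>c\<in>D. 1 / 2 + (if wrong c x then 3 / 2 else 0))"
      by (intro sum.cong) (auto simp: \<phi>_def)
    also have "\<dots> = real (card D) / 2 + 3 / 2 * real (card {c \<in> D. wrong c x})"
      using assms(1) by (simp add: sum.distrib sum.inter_filter[symmetric])
    finally show ?thesis using few[OF that] by linarith
  qed
  \<comment> \<open>Averaging over \<open>D\<close> with the weights \<open>w\<close> fixed: if
    every choice exceeded the average bound, so would the sum over all choices.\<close>
  have "\<exists>c\<in>D. (\<Sum>x\<in>X. w x * \<phi> c x) \<le> 7 / 8 * (\<Sum>x\<in>X. w x)"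
  proof (rule ccontr)
    assume "\<not> ?thesis"
    then have "(\<Sum>c\<in>D. 7 / 8 * (\<Sum>x\<in>X. w x)) < (\<Sum>c\<in>D. \<Sum>x\<in>X. w x * \<phi> c x)"
      using assms by (intro sum_strict_mono) auto
    also have "\<dots> = (\<Sum>x\<in>X. w x * (\<Sum>c\<in>D. \<phi> c x))"
      by (subst sum.swap) (simp add: sum_distrib_left)
    also have "\<dots> \<le> (\<Sum>x\<in>X. w x * (7 / 8 * real (card D)))"
      using avg w by (intro sum_mono mult_left_mono) auto
    also have "\<dots> = (\<Sum>c\<in>D. 7 / 8 * (\<Sum>x\<in>X. w x))"
      by (subst sum_distrib_right[symmetric]) simp
    finally show False by simp
  qed
  then obtain c where c: "c \<in> D" "(\<Sum>x\<in>X. w x * \<phi> c x) \<le> 7 / 8 * (\<Sum>x\<in>X. w x)"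
    by blast
  have "(\<Sum>x\<in>X. \<Prod>c\<leftarrow>c # cs. \<phi> c x) \<le> real (card X) * (7 / 8) ^ Suc l"
    using c(2) cs(3) by (simp add: w_def mult.commute)
  then show ?case
    using c(1) cs(1,2) by (intro exI[of _ "c # cs"]) (simp add: \<phi>_def)
qed

text \<open>The product is 2 to the power of wrong minus correct votes, so a potential below 1 at an
  input means a strict correct majority there.\<close>

lemma prod_list_votes:
  "(\<Prod>c\<leftarrow>cs. if P c then 2 else 1 / 2 :: real) < 1 \<longleftrightarrow>
    length (filter P cs) < length (filter (\<lambda>c. \<not> P c) cs)"
proof -
  have "(\<Prod>c\<leftarrow>cs. if P c then 2 else 1 / 2 :: real) =
      2 ^ length (filter P cs) / 2 ^ length (filter (\<lambda>c. \<not> P c) cs)"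
    by (induction cs) (auto simp: field_simps)
  then show ?thesis by simp
qed

lemma majority_of_good_class:
  assumes "finite D" "D \<noteq> {}" "n > 0"
    and few: "\<And>x. x \<in> cube n \<Longrightarrow> 4 * card {c \<in> D. wrong c x} \<le> card D"
  shows "\<exists>cs. length cs = 6 * n \<and> set cs \<subseteq> D \<and> (\<forall>x\<in>cube n.
    length (filter (\<lambda>c. wrong c x) cs) < length (filter (\<lambda>c. \<not> wrong c x) cs))"
proof -
  obtain cs where cs: "length cs = 6 * n" "set cs \<subseteq> D"
    "(\<Sum>x\<in>cube n. \<Prod>c\<leftarrow>cs. if wrong c x then 2 else 1 / 2 :: real) \<le> real (card (cube n)) * (7 / 8) ^ (6 * n)"
    using small_potential[where wrong = wrong, OF assms(1,2) finite_cube few] by blast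
  have card_cube: "card (cube n) = 2 ^ n"
    using card_lists_length_eq[of "UNIV :: bool set" n] by (simp add: cube_def)
  \<comment> \<open>\<open>6 * n\<close> votes suffice because \<open>2 * (7/8)^6 < 1\<close>: the
    total over the \<open>2^n\<close> inputs falls below 1, and then so does each single
    term.\<close>
  have "real (card (cube n)) * (7 / 8) ^ (6 * n) = (2 * (7 / 8) ^ 6) ^ n"
    by (simp add: card_cube power_mult power_mult_distrib)
  also have "\<dots> < 1"
    using assms(3) by (intro power_Suc_less_one power_less_one_iff[THEN iffD2]) (auto simp: field_simps)
  finally have lt: "(\<Sum>x\<in>cube n. \<Prod>c\<leftarrow>cs. if wrong c x then 2 else 1 / 2 :: real) < 1"
    using cs(3) by simp
  have "(\<Prod>c\<leftarrow>cs. if wrong c x then 2 else 1 / 2 :: real) < 1" if "x \<in> cube n" for x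
  proof -
    have "(\<Prod>c\<leftarrow>cs. if wrong c x then 2 else 1 / 2 :: real) \<le>
        (\<Sum>x\<in>cube n. \<Prod>c\<leftarrow>cs. if wrong c x then 2 else 1 / 2 :: real)"
      using that by (intro member_le_sum finite_cube prod_list_nonneg) auto
    with lt show ?thesis by linarith
  qed
  then show ?thesis using cs by (auto simp: prod_list_votes)
qed

section \<open>Counting small circuits\<close>

lemma card_lists_length_le_bound:
  assumes "finite A"
  shows "card {xs. set xs \<subseteq> A \<and> length xs \<le> k} \<le> (card A + 1) ^ k"
proof -
  have "(\<Sum>i\<le>k. q ^ i) \<le> (q + 1) ^ k" for q :: nat
  proof (induction k)
    case (Suc k)
    have "q * q ^ k \<le> q * (q + 1) ^ k"
      by (intro mult_left_mono power_mono) auto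
    with Suc have "(\<Sum>i\<le>k. q ^ i) + q * q ^ k \<le> (q + 1) ^ k + q * (q + 1) ^ k"
      by (rule add_mono)
    then show ?case by simp
  qed simp
  then show ?thesis
    using card_lists_length_le[OF assms] by simp
qed

definition circuits :: "nat \<Rightarrow> nat \<Rightarrow> circuit set" where
  "circuits n t = {C. is_circuit n C \<and> circuit_size C \<le> t}"

text \<open>There are at most \<open>3 * (n + t)^2\<close> gates reading wires below
  \<open>n + t\<close>; a circuit is a list of at most \<open>t\<close> of them and an output
  wire.\<close>

lemma circuits_bound:
  "finite (circuits n t) \<and> card (circuits n t) \<le> 2 ^ ((3 * (n + t) ^ 2 + 1) * t + (n + t))"
proof -
  define q where "q = n + t"
  define R where "R = {..<q} \<times> {..<q}"
  define A where "A = NotG ` {..<q} \<union> (\<lambda>(i, j). AndG i j) ` R \<union> (\<lambda>(i, j). OrG i j) ` R"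
  have fin: "finite A" by (simp add: A_def R_def)
  have finR: "finite R" by (simp add: R_def)
  have cR: "card R = q ^ 2" by (simp add: R_def power2_eq_square)
  have "card A \<le> card (NotG ` {..<q}) + card ((\<lambda>(i, j). AndG i j) ` R) + card ((\<lambda>(i, j). OrG i j) ` R)"
    unfolding A_def by (rule order_trans[OF card_Un_le add_right_mono[OF card_Un_le]])
  also have "\<dots> \<le> q + q ^ 2 + q ^ 2"
    using card_image_le[of "{..<q}" NotG] card_image_le[of R "\<lambda>(i, j). AndG i j"]
      card_image_le[of R "\<lambda>(i, j). OrG i j"] finR by (intro add_mono) (simp_all add: cR)
  also have "\<dots> \<le> 3 * q ^ 2" using le_square[of q] by (simp add: power2_eq_square)
  finally have cA: "card A \<le> 3 * q ^ 2" .
  define L where "L = {xs. set xs \<subseteq> A \<and> length xs \<le> t}"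
  have "a \<in> A" if "\<forall>i \<in> gate_wires a. i < q" for a
    using that by (cases a) (auto simp: A_def R_def image_iff)
  then have gates: "set gs \<subseteq> A" if "wf_gates n gs" "length gs \<le> t" for gs
    using that by (fastforce simp: wf_gates_def in_set_conv_nth q_def)
  have sub: "circuits n t \<subseteq> L \<times> {..<q}"
    using subsetD[OF gates] by (auto simp: circuits_def is_circuit_iff circuit_size_def L_def q_def)
  have finL: "finite L" unfolding L_def by (rule finite_lists_length_le[OF fin])
  \<comment> \<open>This crude bound turns each count into a power of two whose exponent stays
    polynomial in \<open>n\<close> and \<open>t\<close>.\<close>
  have pow: "m \<le> 2 ^ m" for m :: nat by (simp add: less_imp_le)
  have "card L \<le> (card A + 1) ^ t"
    unfolding L_def by (rule card_lists_length_le_bound[OF fin])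
  also have "\<dots> \<le> (2 ^ (3 * q ^ 2 + 1)) ^ t"
    by (intro power_mono order_trans[OF _ pow]) (use cA in auto)
  finally have "card L * q \<le> 2 ^ ((3 * q ^ 2 + 1) * t) * 2 ^ q"
    unfolding power_mult by (intro mult_mono pow) simp_all
  then have "card (L \<times> {..<q}) \<le> 2 ^ ((3 * q ^ 2 + 1) * t + q)"
    by (simp add: power_add card_cartesian_product)
  with sub finL show ?thesis
    by (metis card_mono finite_SigmaI finite_lessThan finite_subset order_trans q_def)
qed

text \<open>The summands pay for the constants, for running the \<open>l\<close> circuits, and for
  the thresholds up to \<open>l + 1\<close> of their outputs.\<close>

lemma cost_le_majority:
  assumes "n > 0" "length cs = l" "\<And>c. c \<in> set cs \<Longrightarrow> is_circuit n c \<and> circuit_size c \<le> t"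
    and maj: "\<And>x. x \<in> cube n \<Longrightarrow>
      length (filter (\<lambda>c. circuit_val c x \<noteq> f x) cs) < length (filter (\<lambda>c. \<not> circuit_val c x \<noteq> f x) cs)"
  shows "\<exists>g. cost_le (inputs n) (3 + l * t + l * (2 * (l + 2))) {g} \<and> (\<forall>x\<in>cube n. g x = f x)"
proof -
  have "\<exists>h. cost_le (inputs n) t {h} \<and> agrees_on c h (cube n)" if "c \<in> set cs" for c
    using assms(3)[OF that] by (auto elim!: circuit_imp_cost_le intro: cost_le_mono)
  then obtain h where h: "\<And>c. c \<in> set cs \<Longrightarrow> cost_le (inputs n) t {h c}"
    "\<And>c x. c \<in> set cs \<Longrightarrow> x \<in> cube n \<Longrightarrow> circuit_val c x = h c x"
    unfolding agrees_on_def by metis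
  define B where "B = inputs n \<union> ({\<lambda>_. False, \<lambda>_. True} \<union> (\<Union>c\<in>set cs. {h c}))"
  have "inputs n \<noteq> {}" using assms(1) by (auto simp: inputs_def)
  then have "cost_le (inputs n) (3 + card (set cs) * t) ({\<lambda>_. False, \<lambda>_. True} \<union> (\<Union>c\<in>set cs. {h c}))"
    by (intro cost_le_Un cost_le_consts cost_le_UN) (use h(1) in auto)
  then have 1: "cost_le (inputs n) (3 + l * t) ({\<lambda>_. False, \<lambda>_. True} \<union> (\<Union>c\<in>set cs. {h c}))"
    by (rule cost_le_mono) (use card_length[of cs] assms(2) in auto)
  \<comment> \<open>Strictly more than half of \<open>l\<close>: inputs with \<open>f x\<close> get
    at least \<open>k\<close> votes and the others fewer, for even and odd \<open>l\<close>
    alike.\<close>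
  define k where "k = l div 2 + 1"
  have "cost_le B (length (map h cs) * (2 * Suc (l + 1))) (threshold (map h cs) ` {..l + 1})"
    by (rule cost_le_threshold) (auto simp: B_def)
  then have "cost_le B (l * (2 * (l + 2))) {threshold (map h cs) k}"
    by (rule cost_le_mono) (auto simp: assms(2) k_def)
  then have "cost_le (inputs n) (3 + l * t + l * (2 * (l + 2))) {threshold (map h cs) k}"
    using cost_le_seq[OF 1] by (simp add: B_def)
  moreover have "threshold (map h cs) k x = f x" if "x \<in> cube n" for x
  proof -
    have eq: "filter (\<lambda>c. h c x) cs = filter (\<lambda>c. circuit_val c x) cs"
      by (rule filter_cong) (use h(2) that in auto)
    have "length (filter (\<lambda>c. circuit_val c x) cs) + length (filter (\<lambda>c. \<not> circuit_val c x) cs) = l"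
      using sum_length_filter_compl[of "\<lambda>c. circuit_val c x" cs] assms(2) by simp
    then show ?thesis
      using maj[OF that] eq by (cases "f x") (auto simp: threshold_def filter_map o_def k_def)
  qed
  ultimately show ?thesis by blast
qed

text \<open>The greedy refutation can only stall at a class from which a majority vote computes
  \<open>f\<close>, and \<open>hard\<close> rules that out.\<close>

lemma ex_anticheckers:
  assumes "n > 0"
    and hard: "\<not> (\<exists>C. computes n C f \<and> circuit_size C \<le> 3 + 6 * n * t + 6 * n * (2 * (6 * n + 2)))"
  shows "\<exists>S. anticheckers n f (3 * ((3 * (n + t) ^ 2 + 1) * t + (n + t) + 1)) t S"
proof -
  define e where "e = (3 * (n + t) ^ 2 + 1) * t + (n + t)"
  have fin: "finite (circuits n t)" and card: "card (circuits n t) \<le> 2 ^ e"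
    using circuits_bound[of n t] by (auto simp: e_def)
  define wrong where "wrong C x \<longleftrightarrow> circuit_val C x \<noteq> f x" for C x
  have stuck: "\<exists>x\<in>cube n. card D \<le> 4 * card {c \<in> D. wrong c x}"
    if D: "D \<subseteq> circuits n t" "D \<noteq> {}" for D
  proof (rule ccontr)
    assume "\<not> ?thesis"
    then have few: "\<And>x. x \<in> cube n \<Longrightarrow> 4 * card {c \<in> D. wrong c x} \<le> card D"
      by force
    obtain cs where cs: "length cs = 6 * n" "set cs \<subseteq> D" "\<forall>x\<in>cube n.
        length (filter (\<lambda>c. wrong c x) cs) < length (filter (\<lambda>c. \<not> wrong c x) cs)"
      using majority_of_good_class[where wrong = wrong, OF finite_subset[OF D(1) fin] D(2) assms(1) few] by blast
    obtain g where g: "cost_le (inputs n) (3 + 6 * n * t + 6 * n * (2 * (6 * n + 2))) {g}"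
      "\<forall>x\<in>cube n. g x = f x"
      using cost_le_majority[OF assms(1) cs(1), of t f] cs(2,3) D(1)
      by (auto simp: circuits_def wrong_def)
    show False
      using cost_le_imp_circuit[OF g(1)] g(2) hard
      unfolding computes_def agrees_on_def by metis
  qed
  \<comment> \<open>Three rounds shrink the class by the factor \<open>27/64 < 1/2\<close>, so
    \<open>3 * (e + 1)\<close> rounds exhaust at most \<open>2 ^ e\<close> circuits.\<close>
  have "3 ^ (3 * (e + 1)) * card (circuits n t) \<le> 3 ^ (3 * (e + 1)) * 2 ^ e"
    using card by (intro mult_left_mono) auto
  also have "\<dots> < 27 ^ (e + 1) * 2 ^ (e + 1)"
    using power_mult[of "3 :: nat" 3 "e + 1"] by simp
  also have "\<dots> = 54 ^ (e + 1)"
    by (simp only: power_mult_distrib[symmetric]) simp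
  also have "\<dots> \<le> 64 ^ (e + 1)"
    by (rule power_mono) auto
  also have "\<dots> = 4 ^ (3 * (e + 1))"
    using power_mult[of "4 :: nat" 3 "e + 1"] by simp
  finally obtain S where "S \<subseteq> cube n" "card S \<le> 3 * (e + 1)"
    "\<forall>c\<in>circuits n t. \<exists>x\<in>S. wrong c x"
    using ex_small_refuting_set[OF fin _ stuck] by meson
  then show ?thesis
    unfolding anticheckers_def e_def
    by (intro exI[of _ S]) (auto simp: circuits_def agrees_on_def wrong_def)
qed


section \<open>The fusion method\<close>

text \<open>The family generated from \<open>x\<close> by \<open>\<Lambda>\<close> consists of the sets derivable once the set of
  fired pairs has stabilised; inclusion in \<open>W\<close> is imposed only later, since a pair that is not
  made of subsets of \<open>W\<close> covers no semi-filter.\<close>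

definition derivable ::
    "bool list set \<Rightarrow> nat \<Rightarrow> bool list \<Rightarrow> (bool list set \<times> bool list set) set \<Rightarrow> bool list set \<Rightarrow> bool" where
  "derivable W n x D A \<longleftrightarrow>
    (\<exists>i<n. {y \<in> W. y ! i = x ! i} \<subseteq> A) \<or> (\<exists>P\<in>D. fst P \<inter> snd P \<subseteq> A)"

text \<open>Pairs fire in parallel rounds, so that each round becomes a layer of a circuit computed
  from the previous stage alone.\<close>

primrec fired ::
    "bool list set \<Rightarrow> nat \<Rightarrow> (bool list set \<times> bool list set) set \<Rightarrow> nat \<Rightarrow> bool list
      \<Rightarrow> (bool list set \<times> bool list set) set" where
  "fired W n \<Lambda> 0 x = {}"
| "fired W n \<Lambda> (Suc t) x = {P \<in> \<Lambda>.
    derivable W n x (fired W n \<Lambda> t x) (fst P) \<and> derivable W n x (fired W n \<Lambda> t x) (snd P)}"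

lemma fired_subset: "fired W n \<Lambda> t x \<subseteq> \<Lambda>"
  by (cases t) auto

lemma derivable_mono: "derivable W n x D A \<Longrightarrow> D \<subseteq> D' \<Longrightarrow> A \<subseteq> A' \<Longrightarrow> derivable W n x D' A'"
  unfolding derivable_def by blast

lemma fired_Suc_mono: "fired W n \<Lambda> t x \<subseteq> fired W n \<Lambda> (Suc t) x"
proof (induction t)
  case (Suc t)
  then show ?case
    using derivable_mono[OF _ Suc order_refl] by auto
qed simp

lemma fired_stable:
  assumes "finite \<Lambda>"
  shows "fired W n \<Lambda> (Suc (card \<Lambda>)) x = fired W n \<Lambda> (card \<Lambda>) x"
proof -
  \<comment> \<open>A round either fires a new pair or nothing changes from then on, so
    \<open>t\<close> productive rounds yield at least \<open>t\<close> pairs.\<close>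
  have "t \<le> card (fired W n \<Lambda> t x) \<or> fired W n \<Lambda> (Suc t) x = fired W n \<Lambda> t x" for t
  proof (induction t)
    case (Suc t)
    show ?case
    proof (cases "fired W n \<Lambda> (Suc t) x = fired W n \<Lambda> t x")
      case True
      then show ?thesis by simp
    next
      case False
      then have "fired W n \<Lambda> t x \<subset> fired W n \<Lambda> (Suc t) x"
        using fired_Suc_mono by blast
      then have "card (fired W n \<Lambda> t x) < card (fired W n \<Lambda> (Suc t) x)"
        by (intro psubset_card_mono finite_subset[OF fired_subset assms])
      then show ?thesis using Suc False by linarith
    qed
  qed simp
  moreover have "fired W n \<Lambda> (card \<Lambda>) x = \<Lambda>" if "card \<Lambda> \<le> card (fired W n \<Lambda> (card \<Lambda>) x)"
    using that fired_subset assms by (meson card_seteq)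
  ultimately show ?thesis
    using fired_subset fired_Suc_mono by (metis subset_antisym)
qed

text \<open>Soundness on \<open>W\<close>: \<open>x\<close> lies in each generating bracket, and by
  the earlier stage in both sides of a fired pair, hence in their intersection.\<close>

lemma derivable_imp_mem:
  assumes "x \<in> W" "derivable W n x (fired W n \<Lambda> t x) A"
  shows "x \<in> A"
  using assms(2)
proof (induction t arbitrary: A)
  case 0
  then show ?case using assms(1) by (auto simp: derivable_def)
next
  case (Suc t)
  from Suc.prems consider i where "{y \<in> W. y ! i = x ! i} \<subseteq> A"
    | P where "P \<in> fired W n \<Lambda> (Suc t) x" "fst P \<inter> snd P \<subseteq> A"
    unfolding derivable_def by blast
  then show ?case
    using Suc.IH assms(1) by cases auto
qed

definition conflict :: "bool list set \<Rightarrow> nat \<Rightarrow> (bool list set \<times> bool list set) set \<Rightarrow> bool list \<Rightarrow> bool" where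
  "conflict W n \<Lambda> x \<longleftrightarrow>
    (\<exists>i<n. derivable W n x (fired W n \<Lambda> (card \<Lambda>) x) {y \<in> W. y ! i \<noteq> x ! i})"

text \<open>The derivable subsets of \<open>W\<close> form the semi-filter, with \<open>x\<close> as
  its string. Absence of conflict keeps out the false literals and with them, by upward closure, the
  empty set.\<close>

lemma no_conflict_imp_uncovered:
  assumes "n > 0" "finite \<Lambda>" "x \<in> ones n f \<inter> S"
    and nc: "\<not> conflict (zeros n f \<inter> S) n \<Lambda> x"
  shows "\<exists>F. semi_filter (zeros n f \<inter> S) F \<and> v_in_VS n f S F \<and> (\<forall>P\<in>\<Lambda>. \<not> covers P F)"
proof -
  define W where "W = zeros n f \<inter> S"
  define D where "D = fired W n \<Lambda> (card \<Lambda>) x"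
  define F where "F = {A. A \<subseteq> W \<and> derivable W n x D A}"
  have nc': "{y \<in> W. y ! i \<noteq> x ! i} \<notin> F" if "i < n" for i
    using nc that by (auto simp: conflict_def W_def D_def F_def)
  have lit: "{y \<in> W. y ! i = x ! i} \<in> F" if "i < n" for i
    using that by (auto simp: F_def derivable_def)
  have up: "B \<in> F" if "A \<in> F" "A \<subseteq> B" "B \<subseteq> W" for A B
    using that by (auto simp: F_def intro: derivable_mono)
  have "{} \<notin> F"
    using nc'[of 0] up[of "{}"] assms(1) by fastforce
  moreover have "W \<in> F"
    using up[OF lit[of 0]] assms(1) by auto
  ultimately have sf: "semi_filter W F"
    using up by (auto simp: semi_filter_def F_def)
  have br: "bracket n f S (\<lambda>x. x ! i) = {y \<in> W. y ! i}"
    "bracket n f S (\<lambda>x. \<not> x ! i) = {y \<in> W. \<not> y ! i}" for i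
    by (auto simp: bracket_def W_def ones_def zeros_def)
  have mem: "({y \<in> W. y ! i} \<in> F) = x ! i" "({y \<in> W. \<not> y ! i} \<in> F) = (\<not> x ! i)" if "i < n" for i
    using lit[OF that] nc'[OF that] by (cases "x ! i"; simp)+
  have "vstring n f S F = map (\<lambda>i. x ! i) [0..<n]"
    unfolding vstring_def using mem br by auto
  also have "\<dots> = x"
    using assms(3) by (auto simp: ones_def cube_def intro: nth_equalityI)
  finally have "v_in_VS n f S F"
    using assms(3) mem br by (auto simp: v_in_VS_def)
  moreover have "\<not> covers P F" if "P \<in> \<Lambda>" for P
  proof
    assume c: "covers P F"
    \<comment> \<open>Both sides of a covering pair are derivable, so it fires in the next round; by
      stability it has fired already, which puts its intersection into \<open>F\<close>.\<close>
    then have "P \<in> fired W n \<Lambda> (Suc (card \<Lambda>)) x"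
      using that by (auto simp: covers_def F_def D_def)
    then have "P \<in> D"
      unfolding fired_stable[OF assms(2)] D_def .
    then have "fst P \<inter> snd P \<in> F"
      using c by (auto simp: F_def covers_def derivable_def)
    then show False using c by (simp add: covers_def)
  qed
  ultimately show ?thesis using sf by (auto simp: W_def)
qed

section \<open>Gate count of the conflict test\<close>

definition literals :: "nat \<Rightarrow> (bool list \<Rightarrow> bool) set" where
  "literals n = (\<lambda>(i, b) x. x ! i = b) ` ({..<n} \<times> UNIV)"

lemma cost_le_literals: "cost_le (inputs n) n (literals n)"
proof -
  have "cost_le (inputs n) (card {..<n} * 1) (\<Union>i\<in>{..<n}. {\<lambda>x. \<not> x ! i})"
    by (intro cost_le_UN cost_le_neg) (auto simp: inputs_def)
  then have "cost_le (inputs n) (0 + n) (inputs n \<union> (\<Union>i\<in>{..<n}. {\<lambda>x. \<not> x ! i}))"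
    by (intro cost_le_Un cost_le_subset) auto
  moreover have "literals n = inputs n \<union> (\<Union>i\<in>{..<n}. {\<lambda>x. \<not> x ! i})"
    by (auto simp: literals_def inputs_def UNIV_bool image_iff)
  ultimately show ?thesis by simp
qed

text \<open>Which brackets and intersections lie inside a fixed \<open>A\<close> does not depend on
  \<open>x\<close>, so the test is a disjunction of at most \<open>2 * n\<close> fixed literals and
  \<open>card \<Lambda>\<close> fixed indicators of fired pairs.\<close>

lemma cost_le_derivable:
  assumes "finite \<Lambda>" "(\<lambda>_. False) \<in> B" "literals n \<subseteq> B" "\<And>P. P \<in> \<Lambda> \<Longrightarrow> (\<lambda>x. P \<in> D x) \<in> B"
    and D: "\<And>x. D x \<subseteq> \<Lambda>"
  shows "cost_le B (2 * n + card \<Lambda> + 1) {\<lambda>x. derivable W n x (D x) A}"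
proof -
  define I where "I = {p \<in> {..<n} \<times> UNIV. {y \<in> W. y ! fst p = snd p} \<subseteq> A}"
  define J where "J = {P \<in> \<Lambda>. fst P \<inter> snd P \<subseteq> A}"
  have "card I \<le> card ({..<n} \<times> (UNIV :: bool set))"
    unfolding I_def by (intro card_mono) auto
  then have I: "finite I" "card I \<le> 2 * n"
    by (auto simp: I_def)
  have J: "finite J" "card J \<le> card \<Lambda>"
    using assms(1) by (auto simp: J_def intro: card_mono)
  let ?g = "\<lambda>x. \<exists>p\<in>I. x ! fst p = snd p" and ?h = "\<lambda>x. \<exists>P\<in>J. P \<in> D x"
  have "(\<lambda>x. x ! fst p = snd p) \<in> literals n" if "p \<in> I" for p
    using that by (auto simp: literals_def I_def image_iff)
  then have "cost_le B (card I) {?g}"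
    using I assms by (intro cost_le_Bex) auto
  moreover have "cost_le B (card J) {?h}"
    using J assms(2,4) by (intro cost_le_Bex) (auto simp: J_def)
  ultimately have "cost_le B (card I + card J) ({?g} \<union> {?h})"
    by (rule cost_le_Un)
  then have "cost_le B (card I + card J + 1) {\<lambda>x. ?g x \<or> ?h x}"
    by (rule cost_le_seq) (rule cost_le_disj, auto)
  moreover have "(\<lambda>x. ?g x \<or> ?h x) = (\<lambda>x. derivable W n x (D x) A)"
  proof
    fix x
    have "?g x \<longleftrightarrow> (\<exists>i<n. {y \<in> W. y ! i = x ! i} \<subseteq> A)"
      by (force simp: I_def)
    moreover have "?h x \<longleftrightarrow> (\<exists>P\<in>D x. fst P \<inter> snd P \<subseteq> A)"
      unfolding J_def using D by blast
    ultimately show "(?g x \<or> ?h x) = derivable W n x (D x) A"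
      by (simp only: derivable_def)
  qed
  ultimately have "cost_le B (card I + card J + 1) {\<lambda>x. derivable W n x (D x) A}"
    by (simp only:)
  then show ?thesis
    by (rule cost_le_mono) (use I J in auto)
qed

text \<open>Per round, each pair costs two derivability tests and a conjunction:
  \<open>2 * (2 * n + card \<Lambda> + 1) + 1\<close> gates.\<close>

lemma cost_le_fired:
  assumes "finite \<Lambda>" "(\<lambda>_. False) \<in> B" "literals n \<subseteq> B"
  shows "cost_le B (t * (card \<Lambda> * (4 * n + 2 * card \<Lambda> + 3))) ((\<lambda>P x. P \<in> fired W n \<Lambda> t x) ` \<Lambda>)"
proof (induction t)
  case 0
  show ?case using assms(2) by (auto intro: cost_le_subset)
next
  case (Suc t)
  let ?B = "B \<union> (\<lambda>P x. P \<in> fired W n \<Lambda> t x) ` \<Lambda>"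
  let ?d = "\<lambda>A x. derivable W n x (fired W n \<Lambda> t x) A"
  let ?m = "2 * n + card \<Lambda> + 1"
  have step: "cost_le ?B (4 * n + 2 * card \<Lambda> + 3) {\<lambda>x. P \<in> fired W n \<Lambda> (Suc t) x}" if "P \<in> \<Lambda>" for P
  proof -
    have "cost_le ?B ?m {?d A}" for A
      using assms by (intro cost_le_derivable fired_subset) auto
    then have "cost_le ?B (?m + ?m) ({?d (fst P)} \<union> {?d (snd P)})"
      by (intro cost_le_Un)
    then have "cost_le ?B (?m + ?m + 1) {\<lambda>x. ?d (fst P) x \<and> ?d (snd P) x}"
      by (rule cost_le_seq) (rule cost_le_conj, auto)
    moreover have "4 * n + 2 * card \<Lambda> + 3 = ?m + ?m + 1" by simp
    ultimately show ?thesis using that by (simp only: fired.simps mem_Collect_eq simp_thms)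
  qed
  have "cost_le ?B (card \<Lambda> * (4 * n + 2 * card \<Lambda> + 3)) (\<Union>P\<in>\<Lambda>. {\<lambda>x. P \<in> fired W n \<Lambda> (Suc t) x})"
    using assms(1) step by (rule cost_le_UN)
  from cost_le_seq[OF Suc this] show ?case
    by (simp add: UNION_singleton_eq_range add.commute)
qed

text \<open>The bracket of a literal false at \<open>x\<close> depends on \<open>x\<close>, so each
  of the \<open>2 * n\<close> cases \<open>x ! i = b\<close> gets its own test, guarded by that
  literal.\<close>

lemma cost_le_conflict:
  assumes "n > 0" "finite \<Lambda>"
  shows "cost_le (inputs n)
    (3 + n + card \<Lambda> * (card \<Lambda> * (4 * n + 2 * card \<Lambda> + 3)) + 2 * n * (2 * n + card \<Lambda> + 3))
    {conflict W n \<Lambda>}"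
proof -
  define m where "m = card \<Lambda>"
  define D where "D = fired W n \<Lambda> m"
  define B0 where "B0 = inputs n \<union> ({\<lambda>_. False, \<lambda>_. True} \<union> literals n)"
  define B where "B = B0 \<union> (\<lambda>P x. P \<in> D x) ` \<Lambda>"
  define I where "I = {..<n} \<times> (UNIV :: bool set)"
  define d where "d p x \<longleftrightarrow> derivable W n x (D x) {y \<in> W. y ! fst p \<noteq> snd p}" for p x
  define e where "e p x \<longleftrightarrow> x ! fst p = snd p \<and> d p x" for p x
  have "inputs n \<noteq> {}" using assms(1) by (auto simp: inputs_def)
  then have 0: "cost_le (inputs n) (3 + n) ({\<lambda>_. False, \<lambda>_. True} \<union> literals n)"
    by (intro cost_le_Un cost_le_consts cost_le_literals)
  have 1: "cost_le B0 (m * (m * (4 * n + 2 * m + 3))) ((\<lambda>P x. P \<in> D x) ` \<Lambda>)"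
    unfolding m_def D_def using assms(2) by (rule cost_le_fired) (auto simp: B0_def)
  have "cost_le B (2 * n + m + 2) {e p}" if "p \<in> I" for p
  proof -
    have d: "cost_le B (2 * n + m + 1) {d p}"
      unfolding d_def m_def using assms(2)
      by (rule cost_le_derivable) (auto simp: B_def B0_def D_def fired_subset[THEN subsetD])
    have "(\<lambda>x. x ! fst p = snd p) \<in> B"
      using that by (auto simp: B_def B0_def I_def literals_def image_iff)
    then have e: "cost_le (B \<union> {d p}) 1 {e p}"
      unfolding e_def by (intro cost_le_conj) auto
    show ?thesis
      by (rule cost_le_mono[OF cost_le_seq[OF d e]]) auto
  qed
  then have "cost_le B (card I * (2 * n + m + 2)) (\<Union>p\<in>I. {e p})"
    by (intro cost_le_UN) (auto simp: I_def)
  moreover have "cost_le (B \<union> (\<Union>p\<in>I. {e p})) (card I) {\<lambda>x. \<exists>p\<in>I. e p x}"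
    by (intro cost_le_Bex) (auto simp: I_def B_def B0_def)
  ultimately have "cost_le B (card I * (2 * n + m + 2) + card I) {\<lambda>x. \<exists>p\<in>I. e p x}"
    by (rule cost_le_seq)
  moreover have "(\<lambda>x. \<exists>p\<in>I. e p x) = conflict W n \<Lambda>"
    by (auto simp: conflict_def fun_eq_iff I_def e_def d_def D_def m_def)
  moreover have "card I * (2 * n + m + 2) + card I = 2 * n * (2 * n + m + 3)"
    by (simp add: I_def algebra_simps)
  ultimately have "cost_le B (2 * n * (2 * n + m + 3)) {conflict W n \<Lambda>}"
    by (simp only:)
  then have "cost_le B0 (m * (m * (4 * n + 2 * m + 3)) + 2 * n * (2 * n + m + 3)) {conflict W n \<Lambda>}"
    unfolding B_def by (rule cost_le_seq[OF 1])
  then have "cost_le (inputs n) (3 + n + (m * (m * (4 * n + 2 * m + 3)) + 2 * n * (2 * n + m + 3)))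
      {conflict W n \<Lambda>}"
    unfolding B0_def by (rule cost_le_seq[OF 0])
  then show ?thesis
    by (simp only: m_def add.assoc)
qed

text \<open>Otherwise the conflict test would accept all of \<open>V \<inter> S\<close> and reject
  all of \<open>U \<inter> S\<close>, giving a circuit excluded by \<open>hard\<close>.\<close>

lemma ex_uncovered:
  assumes "n > 0" "S \<subseteq> cube n" "finite \<Lambda>"
    and hard: "\<not> (\<exists>C. is_circuit n C \<and> agrees_on C f S \<and> circuit_size C \<le>
      3 + n + card \<Lambda> * (card \<Lambda> * (4 * n + 2 * card \<Lambda> + 3)) + 2 * n * (2 * n + card \<Lambda> + 3))"
  shows "\<exists>F. semi_filter (zeros n f \<inter> S) F \<and> v_in_VS n f S F \<and> (\<forall>P\<in>\<Lambda>. \<not> covers P F)"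
proof (rule ccontr)
  assume covered: "\<not> ?thesis"
  let ?W = "zeros n f \<inter> S"
  obtain C where C: "is_circuit n C" "agrees_on C (conflict ?W n \<Lambda>) (cube n)" "circuit_size C \<le>
      3 + n + card \<Lambda> * (card \<Lambda> * (4 * n + 2 * card \<Lambda> + 3)) + 2 * n * (2 * n + card \<Lambda> + 3)"
    using cost_le_imp_circuit[OF cost_le_conflict[OF assms(1,3)]] by blast
  have "conflict ?W n \<Lambda> x = f x" if x: "x \<in> S" for x
  proof (cases "f x")
    case True
    then have "x \<in> ones n f \<inter> S" using assms(2) x by (auto simp: ones_def)
    then show ?thesis
      using no_conflict_imp_uncovered[OF assms(1,3)] covered True by blast
  next
    case False
    then have "x \<in> ?W" using assms(2) x by (auto simp: zeros_def)
    then show ?thesis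
      using derivable_imp_mem[of x ?W] False by (fastforce simp: conflict_def)
  qed
  then have "agrees_on C f S"
    using C(2) assms(2) by (auto simp: agrees_on_def)
  then show False using C(1,3) hard by blast
qed

section \<open>Choosing the family of semi-filters\<close>

lemma finite_subsets_bound:
  assumes "finite A"
  shows "finite {X. X \<subseteq> A \<and> card X \<le> k} \<and> card {X. X \<subseteq> A \<and> card X \<le> k} \<le> (card A + 1) ^ k"
proof -
  have "{X. X \<subseteq> A \<and> card X \<le> k} \<subseteq> set ` {xs. set xs \<subseteq> A \<and> length xs \<le> k}"
  proof
    fix X assume X: "X \<in> {X. X \<subseteq> A \<and> card X \<le> k}"
    then obtain xs where "set xs = X" "distinct xs"
      using assms finite_distinct_list finite_subset by (metis mem_Collect_eq)
    with X show "X \<in> set ` {xs. set xs \<subseteq> A \<and> length xs \<le> k}"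
      by (auto simp: distinct_card image_iff intro!: exI[of _ xs])
  qed
  then have "card {X. X \<subseteq> A \<and> card X \<le> k} \<le> card {xs. set xs \<subseteq> A \<and> length xs \<le> k}"
    using finite_lists_length_le[OF assms, of k] by (meson card_image_le card_mono finite_imageI order_trans)
  then show ?thesis
    using card_lists_length_le_bound[OF assms, of k] assms by auto
qed

text \<open>A covering with fewer than \<open>s\<close> pairs would have to cover the semi-filter
  that was chosen against it. The size bound counts the sets of fewer than \<open>s\<close>
  pairs.\<close>

lemma ex_semi_filters:
  assumes uncovered: "\<And>\<Lambda>. finite \<Lambda> \<Longrightarrow> card \<Lambda> < s \<Longrightarrow>
      \<exists>F. semi_filter (zeros n f \<inter> S) F \<and> v_in_VS n f S F \<and> (\<forall>P\<in>\<Lambda>. \<not> covers P F)"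
    and "S \<subseteq> cube n"
  shows "\<exists>F0. (\<forall>F \<in> F0. semi_filter (zeros n f \<inter> S) F \<and> v_in_VS n f S F) \<and>
    card F0 \<le> 2 ^ ((2 * card S + 1) * s) \<and> rho n f S F0 \<ge> s"
proof (cases "s = 0")
  \<comment> \<open>Treated apart because \<open>s - 1\<close> truncates: for \<open>s = 0\<close>,
    \<open>card \<Lambda> \<le> s - 1\<close> would not give
    \<open>card \<Lambda> < s\<close>.\<close>
  case True
  then show ?thesis by (intro exI[of _ "{}"]) auto
next
  case False
  define W where "W = zeros n f \<inter> S"
  define Q where "Q = Pow W \<times> Pow W"
  define \<L> where "\<L> = {\<Lambda>. \<Lambda> \<subseteq> Q \<and> card \<Lambda> \<le> s - 1}"
  have finS: "finite S" using assms(2) finite_cube finite_subset by blast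
  then have finW: "finite W" "card W \<le> card S" by (auto simp: W_def intro: card_mono)
  then have finQ: "finite Q" by (simp add: Q_def)
  have finite_\<L>: "finite \<L>" and card_\<L>: "card \<L> \<le> (card Q + 1) ^ (s - 1)"
    using finite_subsets_bound[OF finQ] by (auto simp: \<L>_def)
  have "\<exists>F. semi_filter W F \<and> v_in_VS n f S F \<and> (\<forall>P\<in>\<Lambda>. \<not> covers P F)" if "\<Lambda> \<in> \<L>" for \<Lambda>
    unfolding W_def using that False finite_subset[OF _ finQ] by (intro uncovered) (auto simp: \<L>_def)
  then obtain F where F: "\<And>\<Lambda>. \<Lambda> \<in> \<L> \<Longrightarrow> semi_filter W (F \<Lambda>) \<and> v_in_VS n f S (F \<Lambda>) \<and>
      (\<forall>P\<in>\<Lambda>. \<not> covers P (F \<Lambda>))"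
    by metis
  have sf: "\<forall>G \<in> F ` \<L>. semi_filter (zeros n f \<inter> S) G \<and> v_in_VS n f S G"
    using F by (auto simp: W_def)
  have "card Q = 2 ^ (2 * card W)"
    using finW by (simp add: Q_def card_cartesian_product card_Pow power_add mult_2)
  also have "\<dots> \<le> 2 ^ (2 * card S)"
    using finW by (intro power_increasing) auto
  finally have "card Q + 1 \<le> 2 ^ (2 * card S) + 2 ^ (2 * card S)"
    by (intro add_mono) auto
  then have "card Q + 1 \<le> 2 ^ (2 * card S + 1)" by simp
  then have "(card Q + 1) ^ (s - 1) \<le> (2 ^ (2 * card S + 1)) ^ (s - 1)"
    by (rule power_mono) simp
  also have "\<dots> \<le> (2 ^ (2 * card S + 1)) ^ s"
    by (rule power_increasing) auto
  finally have "card (F ` \<L>) \<le> 2 ^ ((2 * card S + 1) * s)"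
    using card_\<L> card_image_le[OF finite_\<L>, of F] unfolding power_mult by linarith
  moreover have "rho n f S (F ` \<L>) \<ge> s"
  proof (rule ccontr)
    assume "\<not> ?thesis"
    \<comment> \<open>\<open>LEAST\<close> denotes an attained minimum only if some covering exists;
      \<open>ex_covering\<close> supplies one.\<close>
    moreover have "\<exists>k \<Lambda>. covering (zeros n f \<inter> S) (F ` \<L>) \<Lambda> \<and> card \<Lambda> = k"
      using ex_covering[OF sf] by blast
    then have "\<exists>\<Lambda>. covering (zeros n f \<inter> S) (F ` \<L>) \<Lambda> \<and> card \<Lambda> = rho n f S (F ` \<L>)"
      unfolding rho_def by (rule LeastI_ex)
    ultimately obtain \<Lambda> where \<Lambda>: "covering W (F ` \<L>) \<Lambda>" "card \<Lambda> < s"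
      by (auto simp: W_def)
    then have "\<Lambda> \<in> \<L>" by (auto simp: \<L>_def Q_def covering_def)
    then show False using \<Lambda>(1) F by (auto simp: covering_def)
  qed
  ultimately show ?thesis using sf by blast
qed

section \<open>Numerical estimates and assembly\<close>

lemma majority_size_le:
  fixes n s :: nat
  assumes "n \<le> s" "100 \<le> s"
  shows "3 + 6 * n * s ^ 4 + 6 * n * (2 * (6 * n + 2)) \<le> s ^ 7"
proof -
  have "3 + 6 * n * s ^ 4 + 6 * n * (2 * (6 * n + 2)) \<le> 3 * s ^ 5 + 6 * s * s ^ 4 + 6 * s * (2 * (6 * s + 2 * s))"
    using assms by (intro add_mono mult_mono) auto
  also have "\<dots> = 9 * s ^ 5 + 96 * s ^ 2"
    by (simp add: power_numeral_reduce)
  also have "\<dots> \<le> 9 * s ^ 5 + 96 * s ^ 5"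
    using assms by (intro add_mono mult_left_mono power_increasing) auto
  also have "\<dots> \<le> s ^ 2 * s ^ 5"
    unfolding add_mult_distrib[symmetric]
    using power_mono[OF assms(2), of 2] by (intro mult_right_mono) auto
  also have "\<dots> = s ^ 7"
    by (simp flip: power_add)
  finally show ?thesis .
qed

lemma fusion_size_le:
  fixes m n s :: nat
  assumes "n \<le> s" "m \<le> s" "100 \<le> s"
  shows "3 + n + m * (m * (4 * n + 2 * m + 3)) + 2 * n * (2 * n + m + 3) \<le> s ^ 4"
proof -
  have "3 + n + m * (m * (4 * n + 2 * m + 3)) + 2 * n * (2 * n + m + 3) \<le>
      3 * s + s + s * (s * (4 * s + 2 * s + 3 * s)) + 2 * s * (2 * s + s + 3 * s)"
    using assms by (intro add_mono mult_mono) auto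
  also have "\<dots> = 4 * s ^ 1 + 9 * s ^ 3 + 12 * s ^ 2"
    by (simp add: power_numeral_reduce)
  also have "\<dots> \<le> 4 * s ^ 3 + 9 * s ^ 3 + 12 * s ^ 3"
    using assms by (intro add_mono mult_left_mono power_increasing) auto
  also have "\<dots> \<le> s * s ^ 3"
    using assms by simp
  also have "\<dots> = s ^ 4"
    by (simp add: power_numeral_reduce)
  finally show ?thesis .
qed

lemma anticheckers_size_le:
  fixes n s :: nat
  assumes "n \<le> s" "100 \<le> s"
  shows "3 * ((3 * (n + s ^ 4) ^ 2 + 1) * s ^ 4 + (n + s ^ 4) + 1) \<le> 48 * s ^ 12"
proof -
  have s: "s ^ i \<le> s ^ j" if "i \<le> j" for i j
    using assms that by (intro power_increasing) auto
  have q: "n + s ^ 4 \<le> 2 * s ^ 4"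
    using assms s[of 1 4] by simp
  have "(n + s ^ 4) ^ 2 \<le> (2 * s ^ 4) ^ 2"
    by (rule power_mono[OF q]) simp
  also have "\<dots> = 4 * s ^ 8"
    by (simp add: power_mult_distrib flip: power_mult)
  finally have "3 * (n + s ^ 4) ^ 2 + 1 \<le> 13 * s ^ 8"
    using s[of 0 8] by simp
  then have "(3 * (n + s ^ 4) ^ 2 + 1) * s ^ 4 \<le> 13 * s ^ 8 * s ^ 4"
    by (rule mult_right_mono) simp
  also have "\<dots> = 13 * s ^ 12"
    by (simp flip: power_add)
  \<comment> \<open>The constant 48 is \<open>3 * (13 + 2 + 1)\<close>.\<close>
  finally show ?thesis
    using q s[of 4 12] s[of 0 12] by simp
qed

theorem theorem7:
  shows "\<exists>K::real. K > 0 \<and> (\<exists>p :: nat poly. \<forall>\<^sub>F n in sequentially.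
    \<forall>(f :: bool list \<Rightarrow> bool) (s :: nat).
      K powr (1 / 7) * real s \<ge> real n \<longrightarrow>
      \<not> (\<exists>C. computes n C f \<and> real (circuit_size C) \<le> K * real s ^ 7) \<longrightarrow>
      (\<exists>S F0.
         anticheckers n f (poly p s) (s ^ 3) S \<and>
         (\<forall>F \<in> F0. semi_filter (zeros n f \<inter> S) F \<and> v_in_VS n f S F) \<and>
         card F0 \<le> 2 ^ poly p s \<and>
         rho n f S F0 \<ge> s))"
proof (rule exI[of _ 1], intro conjI exI[of _ "monom 97 13"])
  \<comment> \<open>\<open>K = 1\<close> reduces the hypothesis to \<open>n \<le> s\<close>. The
    polynomial bounds \<open>(2 * card S + 1) * s\<close> with
    \<open>card S \<le> 48 * s ^ 12\<close>, whence \<open>97 = 2 * 48 + 1\<close> and degree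
    13.\<close>
  have main: "\<exists>S F0. anticheckers n f (97 * s ^ 13) (s ^ 3) S \<and>
      (\<forall>F \<in> F0. semi_filter (zeros n f \<inter> S) F \<and> v_in_VS n f S F) \<and>
      card F0 \<le> 2 ^ (97 * s ^ 13) \<and> rho n f S F0 \<ge> s"
    if n: "n \<ge> 100" "n \<le> s" and hard: "\<not> (\<exists>C. computes n C f \<and> circuit_size C \<le> s ^ 7)"
    for n s f
  proof -
    have s: "100 \<le> s" "n > 0" using n by auto
    \<comment> \<open>Taking \<open>t = s ^ 4\<close> leaves room on both sides: the majority has
      order at most \<open>s ^ 5\<close>, well below \<open>s ^ 7\<close>, and the conflict test has
      order \<open>s ^ 3\<close>, its constant factor being absorbed by the extra power of
      \<open>s\<close>.\<close>
    have "\<not> (\<exists>C. computes n C f \<and> circuit_size C \<le> 3 + 6 * n * s ^ 4 + 6 * n * (2 * (6 * n + 2)))"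
      using hard majority_size_le[OF n(2) s(1)] by (meson order_trans)
    from ex_anticheckers[OF s(2) this] obtain S where "anticheckers n f
        (3 * ((3 * (n + s ^ 4) ^ 2 + 1) * s ^ 4 + (n + s ^ 4) + 1)) (s ^ 4) S"
      by blast
    then have S: "S \<subseteq> cube n" "card S \<le> 48 * s ^ 12"
      "\<not> (\<exists>C. is_circuit n C \<and> circuit_size C \<le> s ^ 4 \<and> agrees_on C f S)"
      using anticheckers_size_le[OF n(2) s(1)] by (auto simp: anticheckers_def)
    have "\<exists>F. semi_filter (zeros n f \<inter> S) F \<and> v_in_VS n f S F \<and> (\<forall>P\<in>\<Lambda>. \<not> covers P F)"
      if "finite \<Lambda>" "card \<Lambda> < s" for \<Lambda>
      using S(3) fusion_size_le[OF n(2) less_imp_le[OF that(2)] s(1)]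
      by (intro ex_uncovered[OF s(2) S(1) that(1)]) (meson order_trans)
    from ex_semi_filters[OF this S(1)] obtain F0 where F0:
      "\<forall>F \<in> F0. semi_filter (zeros n f \<inter> S) F \<and> v_in_VS n f S F"
      "card F0 \<le> 2 ^ ((2 * card S + 1) * s)" "rho n f S F0 \<ge> s"
      by blast
    have "2 * card S + 1 \<le> 97 * s ^ 12"
      using S(2) one_le_power[of s 12] s by linarith
    then have e: "(2 * card S + 1) * s \<le> 97 * s ^ 13"
      using mult_right_mono[of "2 * card S + 1" "97 * s ^ 12" s] by (simp add: power_numeral_reduce)
    have "card F0 \<le> 2 ^ (97 * s ^ 13)"
      by (rule order_trans[OF F0(2) power_increasing[OF e]]) simp
    moreover have "card S * 1 \<le> (2 * card S + 1) * s"
      using s by (intro mult_le_mono) auto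
    then have "card S \<le> 97 * s ^ 13"
      using e by linarith
    moreover have "s ^ 3 \<le> s ^ 4"
      using s by (intro power_increasing) auto
    then have "\<not> (\<exists>C. is_circuit n C \<and> circuit_size C \<le> s ^ 3 \<and> agrees_on C f S)"
      using S(3) by (meson order_trans)
    ultimately show ?thesis
      using S(1) F0(1,3) unfolding anticheckers_def by blast
  qed
  show "\<forall>\<^sub>F n in sequentially. \<forall>(f :: bool list \<Rightarrow> bool) (s :: nat).
      1 powr (1 / 7) * real s \<ge> real n \<longrightarrow>
      \<not> (\<exists>C. computes n C f \<and> real (circuit_size C) \<le> 1 * real s ^ 7) \<longrightarrow>
      (\<exists>S F0.
         anticheckers n f (poly (monom 97 13) s) (s ^ 3) S \<and>
         (\<forall>F \<in> F0. semi_filter (zeros n f \<inter> S) F \<and> v_in_VS n f S F) \<and>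
         card F0 \<le> 2 ^ poly (monom 97 13) s \<and>
         rho n f S F0 \<ge> s)"
  proof (rule eventually_sequentiallyI[of 100], intro allI impI)
    fix n s :: nat and f
    assume n: "100 \<le> n" "1 powr (1 / 7) * real s \<ge> real n"
      and hard: "\<not> (\<exists>C. computes n C f \<and> real (circuit_size C) \<le> 1 * real s ^ 7)"
    have "real (circuit_size C) \<le> 1 * real s ^ 7 \<longleftrightarrow> circuit_size C \<le> s ^ 7" for C
      using of_nat_le_iff[of "circuit_size C" "s ^ 7"] by (simp only: mult_1 of_nat_power)
    with hard have hard': "\<not> (\<exists>C. computes n C f \<and> circuit_size C \<le> s ^ 7)"
      by simp
    have "n \<le> s" using n(2) by simp
    show "\<exists>S F0.
         anticheckers n f (poly (monom 97 13) s) (s ^ 3) S \<and>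
         (\<forall>F \<in> F0. semi_filter (zeros n f \<inter> S) F \<and> v_in_VS n f S F) \<and>
         card F0 \<le> 2 ^ poly (monom 97 13) s \<and>
         rho n f S F0 \<ge> s"
      unfolding poly_monom by (rule main[OF n(1) \<open>n \<le> s\<close> hard'])
  qed
qed simp

end
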